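(* Let $G$ be a simple directed graph and let $m\geq 1$ be an integer. Then $I_{G\to D_m}$ is unmixed.
   Context: Directed graphs are finite with nonempty vertex sets and simple: the underlying graph has no loops and no multiple edges. $D_m$ is the directed graph on $[m]=\{1,\dots,m\}$ whose underlying graph is the complete graph and in which $(i,j)$ is an edge if and only if $i<j$. For directed graphs $G$ on $[n]$ and $H$ on $[m]$, a weak graph homomorphism from $G$ to $H$ is a map $\phi:V(G)\to V(H)$ such that for every $(x,y)\in E(G)$ either $\phi(x)=\phi(y)$ or $(\phi(x),\phi(y))\in E(H)$; the set of these is $\mathrm{WHom}(G,H)$. Let $K$ be a field, $S=K[x_{ij}: i\in[n], j\in[m]]$, $u_\phi=\prod_{i=1}^n x_{i\phi(i)}$ and $I_{G\to H}=(u_\phi:\phi\in\mathrm{WHom}(G,H))\subseteq S$. A monomial ideal is unmixed if all its associated primes have the same height. *)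

theory Defs
  imports
    "HOL-Library.Poly_Mapping"
    "HOL-Library.Extended_Nat"
    "HOL-Library.FuncSet"
    "HOL-Algebra.Ideal"
    "Graph_Theory.Pair_Digraph"
begin

section \<open>Directed graphs\<close>

text \<open>The locale \<^locale>\<open>pair_digraph\<close> gives finiteness, well-formed arcs and absence of loops. The
  underlying undirected graph has no multiple edges iff no two arcs are opposite to each other;
  longer directed cycles are allowed.\<close>

definition simple_digraph :: "'a pair_pre_digraph \<Rightarrow> bool" where
  "simple_digraph G \<longleftrightarrow>
     pair_digraph G \<and> pverts G \<noteq> {} \<and> (\<forall>x y. (x, y) \<in> parcs G \<longrightarrow> (y, x) \<notin> parcs G)"

definition D :: "nat \<Rightarrow> nat pair_pre_digraph" where
  "D m = \<lparr>pverts = {1..m}, parcs = {(i, j). i \<in> {1..m} \<and> j \<in> {1..m} \<and> i < j}\<rparr>"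

text \<open>Maps are extensional, i.e. \<^const>\<open>undefined\<close> outside the vertex set of the source.\<close>

definition WHom :: "'a pair_pre_digraph \<Rightarrow> 'b pair_pre_digraph \<Rightarrow> ('a \<Rightarrow> 'b) set" where
  "WHom G H = {\<phi> \<in> pverts G \<rightarrow>\<^sub>E pverts H.
     \<forall>(x, y) \<in> parcs G. \<phi> x = \<phi> y \<or> (\<phi> x, \<phi> y) \<in> parcs H}"

section \<open>Associated primes, height, unmixedness\<close>

text \<open>The associated primes of the module \<open>R/I\<close>: the primes of the form \<open>I : f\<close>.\<close>

definition associated_primes :: "('a, 'c) ring_scheme \<Rightarrow> 'a set \<Rightarrow> 'a set set" where
  "associated_primes R I =
     {P. primeideal P R \<and> (\<exists>f \<in> carrier R. P = {g \<in> carrier R. g \<otimes>\<^bsub>R\<^esub> f \<in> I})}"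

definition prime_height :: "('a, 'c) ring_scheme \<Rightarrow> 'a set \<Rightarrow> enat" where
  "prime_height R P =
     (SUP k \<in> {k. \<exists>C :: nat \<Rightarrow> 'a set.
        (\<forall>i\<le>k. primeideal (C i) R) \<and> (\<forall>i<k. C i \<subset> C (Suc i)) \<and> C k = P}. enat k)"

definition unmixed :: "('a, 'c) ring_scheme \<Rightarrow> 'a set \<Rightarrow> bool" where
  "unmixed R I \<longleftrightarrow>
     (\<forall>P \<in> associated_primes R I. \<forall>Q \<in> associated_primes R I. prime_height R P = prime_height R Q)"

section \<open>Polynomial rings and the ideal of weak homomorphisms\<close>

text \<open>Elements of \<^typ>\<open>'v \<Rightarrow>\<^sub>0 nat\<close> are monomials (exponent vectors) in variables of type
  \<^typ>\<open>'v\<close>. The ring \<open>mpoly_ring V\<close> consists of the polynomials involving only the variables in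
  \<open>V\<close>; its ideals and their heights are those of this ring, not of the ambient type.\<close>

type_synonym ('v, 'k) mpoly = "('v \<Rightarrow>\<^sub>0 nat) \<Rightarrow>\<^sub>0 'k"

definition mpoly_ring :: "'v set \<Rightarrow> ('v, 'k::field) mpoly ring" where
  "mpoly_ring V = \<lparr>carrier = {p. \<forall>t \<in> Poly_Mapping.keys p. Poly_Mapping.keys t \<subseteq> V},
     monoid.mult = (*), one = 1, ring.zero = 0, add = (+)\<rparr>"

definition mvar :: "'v \<Rightarrow> ('v, 'k::field) mpoly" where
  "mvar v = Poly_Mapping.single (Poly_Mapping.single v 1) 1"

definition whom_ring ::
  "'a pair_pre_digraph \<Rightarrow> 'b pair_pre_digraph \<Rightarrow> ('a \<times> 'b, 'k::field) mpoly ring" where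
  "whom_ring G H = mpoly_ring (pverts G \<times> pverts H)"

definition whom_monomial ::
  "'a pair_pre_digraph \<Rightarrow> ('a \<Rightarrow> 'b) \<Rightarrow> ('a \<times> 'b, 'k::field) mpoly" where
  "whom_monomial G \<phi> = (\<Prod>i \<in> pverts G. mvar (i, \<phi> i))"

definition whom_ideal ::
  "'a pair_pre_digraph \<Rightarrow> 'b pair_pre_digraph \<Rightarrow> ('a \<times> 'b, 'k::field) mpoly set" where
  "whom_ideal G H = genideal (whom_ring G H) (whom_monomial G ` WHom G H)"

lemma mpoly_ring_carrier_iff:
  "p \<in> carrier (mpoly_ring V) \<longleftrightarrow> (\<forall>t \<in> Poly_Mapping.keys p. Poly_Mapping.keys t \<subseteq> V)"
  by (simp add: mpoly_ring_def)

lemma mpoly_ring_simps [simp]: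
  "p \<otimes>\<^bsub>mpoly_ring V\<^esub> q = p * q" "p \<oplus>\<^bsub>mpoly_ring V\<^esub> q = p + q"
  "\<one>\<^bsub>mpoly_ring V\<^esub> = 1" "\<zero>\<^bsub>mpoly_ring V\<^esub> = 0"
  by (simp_all add: mpoly_ring_def)

lemma mpoly_ring_mult_closed:
  assumes "p \<in> carrier (mpoly_ring V)" "q \<in> carrier (mpoly_ring V)"
  shows "p * q \<in> carrier (mpoly_ring V)"
  unfolding mpoly_ring_carrier_iff
proof
  fix t assume "t \<in> Poly_Mapping.keys (p * q)"
  then obtain a b where "t = a + b" "a \<in> Poly_Mapping.keys p" "b \<in> Poly_Mapping.keys q"
    using keys_mult[of p q] by blast
  then show "Poly_Mapping.keys t \<subseteq> V"
    using assms Poly_Mapping.keys_add[of a b] unfolding mpoly_ring_carrier_iff by blast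
qed

lemma mpoly_ring_add_closed:
  "p \<in> carrier (mpoly_ring V) \<Longrightarrow> q \<in> carrier (mpoly_ring V) \<Longrightarrow> p + q \<in> carrier (mpoly_ring V)"
  using Poly_Mapping.keys_add[of p q] unfolding mpoly_ring_carrier_iff by blast

lemma mpoly_ring_cring: "cring (mpoly_ring V)"
proof (rule cringI)
  show "abelian_group (mpoly_ring V)"
  proof (rule abelian_groupI)
    fix p assume p: "p \<in> carrier (mpoly_ring V)"
    then have "- p \<in> carrier (mpoly_ring V)"
      by (simp add: mpoly_ring_carrier_iff)
    then show "\<exists>q \<in> carrier (mpoly_ring V). q \<oplus>\<^bsub>mpoly_ring V\<^esub> p = \<zero>\<^bsub>mpoly_ring V\<^esub>"
      by (intro bexI[of _ "- p"]) simp_all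
  qed (simp_all add: mpoly_ring_add_closed add.assoc add.commute mpoly_ring_carrier_iff[of 0])
  show "comm_monoid (mpoly_ring V)"
    by (rule comm_monoidI)
      (simp_all add: mpoly_ring_mult_closed mult.assoc mult.commute mpoly_ring_carrier_iff[of 1])
qed (simp add: distrib_right)

lemma whom_monomial_closed:
  assumes "\<phi> \<in> WHom G H"
  shows "whom_monomial G \<phi> \<in> carrier (whom_ring G H)"
proof -
  have *: "(\<Prod>i \<in> A. mvar (i, \<phi> i)) \<in> carrier (mpoly_ring (pverts G \<times> pverts H))"
    if "A \<subseteq> pverts G" for A
    using that
  proof (induction A rule: infinite_finite_induct)
    case (insert i A)
    have "mvar (i, \<phi> i) \<in> carrier (mpoly_ring (pverts G \<times> pverts H))"
      using insert.prems assms by (auto simp: mvar_def mpoly_ring_carrier_iff WHom_def)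
    then show ?case using insert by (auto intro: mpoly_ring_mult_closed)
  qed (auto simp: mpoly_ring_carrier_iff)
  show ?thesis unfolding whom_monomial_def whom_ring_def by (rule *) simp
qed

lemma whom_ideal_ideal: "ideal (whom_ideal G H) (whom_ring G H)"
proof -
  have "ring (whom_ring G H)"
    unfolding whom_ring_def by (rule cring.axioms(1)[OF mpoly_ring_cring])
  moreover have "whom_monomial G ` WHom G H \<subseteq> carrier (whom_ring G H)"
    using whom_monomial_closed by blast
  ultimately show ?thesis
    unfolding whom_ideal_def by (rule ring.genideal_ideal)
qed

lemma simple_digraph_D:
  assumes "m \<ge> 1"
  shows "simple_digraph (D m)"
proof -
  have "parcs (D m) \<subseteq> {1..m} \<times> {1..m}"
    by (auto simp: D_def)
  then have "finite (parcs (D m))"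
    by (rule finite_subset) simp
  then have "pair_digraph (D m)"
    by unfold_locales (auto simp: D_def)
  then show ?thesis
    using assms by (auto simp: simple_digraph_def D_def)
qed

end

theory Submission
  imports Defs "HOL-Library.Product_Lexorder" "HOL-Algebra.QuotRing"
begin

text \<open>Weak homomorphisms into \<open>D m\<close> are the maps to \<open>{1..m}\<close> that are isotone for reachability in
  \<open>G\<close>. The minimal vertex covers of their graphs are the sets \<open>{(p 1, 1), \<dots>, (p m, m)}\<close> with
  \<open>p (i + 1)\<close> reachable from \<open>p i\<close>: every isotone self-map of a finite chain has a fixed point, and a
  set without such a multichain is missed by a greedily defined isotone map. Hence the ideal is an
  intersection of primes generated by exactly \<open>m\<close> variables each, and its associated primes are
  among these. A permutation of the variables carries any one of them to any other, so their
  heights agree; the value of the height is never needed.\<close>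

section \<open>Associated primes of intersections of primes\<close>

text \<open>Choose from each ideal an element outside \<open>P\<close> and multiply: the product
  lies in every ideal of the family and, \<open>P\<close> being prime, not in \<open>P\<close>.
  Without any ideal, properness of \<open>P\<close> supplies the element.\<close>

lemma (in cring) ideal_avoidance:
  assumes "finite \<D>" "\<And>J. J \<in> \<D> \<Longrightarrow> ideal J R" "primeideal P R" "\<And>J. J \<in> \<D> \<Longrightarrow> \<not> J \<subseteq> P"
  shows "\<exists>g \<in> carrier R. g \<notin> P \<and> (\<forall>J \<in> \<D>. g \<in> J)"
  using assms
proof (induction \<D> rule: finite_induct)
  case empty
  interpret P: primeideal P R by fact
  show ?case using P.I_notcarr P.a_subset by blast
next
  case (insert J \<D>)
  interpret P: primeideal P R by fact
  obtain g where g: "g \<in> carrier R" "g \<notin> P" "\<forall>J \<in> \<D>. g \<in> J" using insert by auto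
  obtain h where h: "h \<in> J" "h \<notin> P" using insert.prems(3)[of J] by auto
  have J: "ideal J R" using insert.prems by auto
  have hc: "h \<in> carrier R" using ideal.Icarr[OF J h(1)] .
  have "h \<otimes> g \<notin> P" using P.I_prime[OF hc g(1)] g h by blast
  moreover have "h \<otimes> g \<in> J" using ideal.I_r_closed[OF J h(1) g(1)] .
  moreover have "h \<otimes> g \<in> K" if "K \<in> \<D>" for K
    using ideal.I_l_closed[of K R g h] insert.prems(1)[of K] g(3) hc that by auto
  ultimately show ?case using g hc by (intro bexI[of _ "h \<otimes> g"]) auto
qed

text \<open>If \<open>P\<close> is the colon ideal of \<open>I\<close> by \<open>f\<close>, only the
  primes \<open>J\<close> that miss \<open>f\<close> constrain it. Avoidance puts one such
  \<open>J\<close> inside \<open>P\<close>; conversely \<open>g \<otimes> f \<in> J\<close> with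
  \<open>f \<notin> J\<close> forces \<open>g \<in> J\<close>, so \<open>P = J\<close>.\<close>

lemma (in cring) associated_primes_Inter:
  assumes "finite \<D>" and prime: "\<And>J. J \<in> \<D> \<Longrightarrow> primeideal J R"
    and I: "I = {f \<in> carrier R. \<forall>J \<in> \<D>. f \<in> J}"
  shows "associated_primes R I \<subseteq> \<D>"
proof
  fix P assume "P \<in> associated_primes R I"
  then obtain f where P: "primeideal P R" and f: "f \<in> carrier R"
    and P_eq: "P = {g \<in> carrier R. g \<otimes> f \<in> I}"
    unfolding associated_primes_def by auto
  let ?\<D> = "{J \<in> \<D>. f \<notin> J}"
  have "\<exists>J \<in> ?\<D>. J \<subseteq> P"
  proof (rule ccontr)
    assume "\<not> ?thesis"
    then obtain g where g: "g \<in> carrier R" "g \<notin> P" "\<forall>J \<in> ?\<D>. g \<in> J"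
      using ideal_avoidance[of ?\<D> P] assms(1) prime P by (auto simp: primeideal.axioms(1))
    have "g \<otimes> f \<in> J" if J: "J \<in> \<D>" for J
    proof -
      interpret J: primeideal J R using prime J .
      show ?thesis using J g f by (cases "f \<in> J") (auto intro: J.I_l_closed J.I_r_closed)
    qed
    then have "g \<otimes> f \<in> I" using g f I by auto
    then show False using g P_eq by simp
  qed
  then obtain J where J: "J \<in> \<D>" "f \<notin> J" "J \<subseteq> P" by auto
  have "P \<subseteq> J"
  proof
    fix g assume "g \<in> P"
    then have "g \<in> carrier R" "g \<otimes> f \<in> J" using P_eq I J(1) by auto
    then show "g \<in> J" using primeideal.I_prime[OF prime[OF J(1)]] f J(2) by blast
  qed
  with J show "P \<in> \<D>" by auto
qed

section \<open>Height along surjective homomorphisms\<close>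

text \<open>Preimages of primes are prime, so a chain ending in \<open>P\<close> pulls back to a
  chain of the same length ending in the preimage of \<open>P\<close>. Surjectivity keeps every
  inclusion strict.\<close>

lemma prime_height_vimage_ge:
  assumes h: "ring_hom_ring R S h" and R: "cring R" and surj: "h ` carrier R = carrier S"
  shows "prime_height S P \<le> prime_height R {r \<in> carrier R. h r \<in> P}"
proof -
  let ?h = "\<lambda>Q. {r \<in> carrier R. h r \<in> Q}"
  show ?thesis
    unfolding prime_height_def
  proof (rule SUP_subset_mono)
    show "{k. \<exists>C :: nat \<Rightarrow> _. (\<forall>i\<le>k. primeideal (C i) S) \<and> (\<forall>i<k. C i \<subset> C (Suc i)) \<and> C k = P}
      \<subseteq> {k. \<exists>C :: nat \<Rightarrow> _. (\<forall>i\<le>k. primeideal (C i) R) \<and> (\<forall>i<k. C i \<subset> C (Suc i)) \<and> C k = ?h P}"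
    proof clarify
      fix k and C :: "nat \<Rightarrow> _"
      assume pr: "\<forall>i\<le>k. primeideal (C i) S" and less: "\<forall>i<k. C i \<subset> C (Suc i)" and "P = C k"
      have "?h (C i) \<subset> ?h (C (Suc i))" if i: "i < k" for i
      proof -
        obtain s where s: "s \<in> C (Suc i)" "s \<notin> C i" using less i by blast
        have "ideal (C (Suc i)) S" using pr i by (simp add: primeideal.axioms(1))
        then have "s \<in> h ` carrier R" using ideal.Icarr s(1) surj by metis
        then show ?thesis using s less i by blast
      qed
      then show "\<exists>C' :: nat \<Rightarrow> _. (\<forall>i\<le>k. primeideal (C' i) R) \<and> (\<forall>i<k. C' i \<subset> C' (Suc i))
          \<and> C' k = ?h (C k)"
        using pr ring_hom_ring.primeideal_vimage[OF h R] by (intro exI[of _ "\<lambda>i. ?h (C i)"]) auto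
    qed
  qed simp
qed

section \<open>Ideals generated by variables\<close>

lemma poly_mapping_sum_keys:
  "(\<Sum>t \<in> Poly_Mapping.keys p. Poly_Mapping.single t (Poly_Mapping.lookup p t)) = p"
  by (rule poly_mapping_eqI) (simp add: lookup_sum lookup_single when_def in_keys_iff)

lemma ideal_add_cancel_left:
  fixes R (structure)
  assumes "ideal J R" "a \<in> J" "b \<in> carrier R" "a \<oplus> b \<in> J"
  shows "b \<in> J"
proof -
  interpret ideal J R by fact
  have "(a \<oplus> b) \<ominus> a \<in> J" using assms by (simp add: a_minus_def)
  moreover have "(a \<oplus> b) \<ominus> a = b" using assms Icarr by algebra
  ultimately show ?thesis by simp
qed

text \<open>This is the ideal generated by the variables in \<open>C \<inter> V\<close>. Describing
  it through supports makes membership a condition on each monomial separately.\<close>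

definition var_ideal :: "'v set \<Rightarrow> 'v set \<Rightarrow> ('v, 'k::field) mpoly set" where
  "var_ideal V C = {p \<in> carrier (mpoly_ring V). \<forall>t \<in> Poly_Mapping.keys p. Poly_Mapping.keys t \<inter> C \<noteq> {}}"

lemma keys_add_nat: "Poly_Mapping.keys (s + t :: 'v \<Rightarrow>\<^sub>0 nat) = Poly_Mapping.keys s \<union> Poly_Mapping.keys t"
  by (auto simp: in_keys_iff lookup_add)

lemma var_ideal_mult:
  assumes "p \<in> var_ideal V C" "q \<in> carrier (mpoly_ring V)"
  shows "p * q \<in> var_ideal V C"
proof -
  have "Poly_Mapping.keys t \<inter> C \<noteq> {}" if t: "t \<in> Poly_Mapping.keys (p * q)" for t
  proof -
    obtain a b where "t = a + b" "a \<in> Poly_Mapping.keys p"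
      using keys_mult[of p q] t by blast
    then show ?thesis using assms(1) by (auto simp: var_ideal_def keys_add_nat)
  qed
  then show ?thesis using assms by (auto simp: var_ideal_def mpoly_ring_mult_closed)
qed

lemma var_ideal_add:
  assumes "p \<in> var_ideal V C" "q \<in> var_ideal V C"
  shows "p + q \<in> var_ideal V C"
  using assms Poly_Mapping.keys_add[of p q] by (auto simp: var_ideal_def mpoly_ring_add_closed)

lemma ideal_var_ideal: "ideal (var_ideal V C :: ('v, 'k::field) mpoly set) (mpoly_ring V)"
proof -
  let ?R = "mpoly_ring V :: ('v, 'k) mpoly ring"
  interpret R: cring ?R by (rule mpoly_ring_cring)
  show ?thesis
  proof (rule idealI[OF R.ring_axioms])
    show "subgroup (var_ideal V C) (add_monoid ?R)"
    proof (rule R.add.subgroupI)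
      show "var_ideal V C \<noteq> ({} :: ('v, 'k) mpoly set)"
        by (auto simp: var_ideal_def mpoly_ring_carrier_iff intro: exI[of _ 0])
    next
      fix p :: "('v, 'k) mpoly"
      assume p: "p \<in> var_ideal V C"
      then have "p \<in> carrier ?R" "- p \<in> carrier ?R"
        by (auto simp: var_ideal_def mpoly_ring_carrier_iff)
      then have "\<ominus>\<^bsub>?R\<^esub> p = - p" by (intro R.minus_equality) auto
      then show "\<ominus>\<^bsub>?R\<^esub> p \<in> var_ideal V C"
        using p by (simp add: var_ideal_def mpoly_ring_carrier_iff)
    next
      fix p q :: "('v, 'k) mpoly"
      assume "p \<in> var_ideal V C" "q \<in> var_ideal V C"
      then show "p \<oplus>\<^bsub>?R\<^esub> q \<in> var_ideal V C" using var_ideal_add by simp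
    qed (auto simp: var_ideal_def)
  qed (use var_ideal_mult in \<open>auto simp: mult.commute\<close>)
qed

text \<open>Linearly ordered variables make the polynomial ring a library instance of
  \<^class>\<open>idom\<close>.\<close>

lemma primeideal_var_ideal:
  "primeideal (var_ideal V C :: ('v::linorder, 'k::field) mpoly set) (mpoly_ring V)"
proof (rule primeidealI[OF ideal_var_ideal mpoly_ring_cring])
  have "1 \<in> carrier (mpoly_ring V)" "1 \<notin> var_ideal V C"
    by (auto simp: var_ideal_def mpoly_ring_carrier_iff)
  then show "carrier (mpoly_ring V) \<noteq> (var_ideal V C :: ('v, 'k) mpoly set)" by metis
next
  let ?J = "var_ideal V C :: ('v, 'k) mpoly set"
  fix f g :: "('v, 'k) mpoly"
  assume f: "f \<in> carrier (mpoly_ring V)" and g: "g \<in> carrier (mpoly_ring V)"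
    and "f \<otimes>\<^bsub>mpoly_ring V\<^esub> g \<in> ?J"
  then have fg: "f * g \<in> ?J" by simp
  \<comment> \<open>\<open>avoid p\<close> keeps the terms of \<open>p\<close> that involve no
    variable of \<open>C\<close>: it represents \<open>p\<close> modulo the ideal.\<close>
  define avoid where
    "avoid p = Poly_Mapping.mapp (\<lambda>t c. c when Poly_Mapping.keys t \<inter> C = {}) p" for p :: "('v, 'k) mpoly"
  have lookup_avoid: "Poly_Mapping.lookup (avoid p) t
      = (Poly_Mapping.lookup p t when Poly_Mapping.keys t \<inter> C = {})" for p t
    by (auto simp: avoid_def lookup_mapp when_def in_keys_iff)
  have keys_avoid: "Poly_Mapping.keys (avoid p) = {t \<in> Poly_Mapping.keys p. Poly_Mapping.keys t \<inter> C = {}}" for p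
    by (rule Set.set_eqI) (simp add: in_keys_iff lookup_avoid conj_commute)
  have keys_rest: "Poly_Mapping.keys (p - avoid p) = {t \<in> Poly_Mapping.keys p. Poly_Mapping.keys t \<inter> C \<noteq> {}}" for p
    by (rule Set.set_eqI) (simp add: in_keys_iff lookup_minus lookup_avoid when_def)
  have carr: "avoid p \<in> carrier (mpoly_ring V)" and rest: "p - avoid p \<in> ?J"
    if "p \<in> carrier (mpoly_ring V)" for p
    using that by (auto simp: var_ideal_def mpoly_ring_carrier_iff keys_avoid keys_rest)
  \<comment> \<open>This sum is \<open>f * g - avoid f * avoid g\<close>, so the two products agree
    modulo the ideal.\<close>
  have "(f - avoid f) * g + (g - avoid g) * avoid f \<in> ?J"
    using f g by (intro var_ideal_add var_ideal_mult rest carr)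
  moreover have "((f - avoid f) * g + (g - avoid g) * avoid f) + avoid f * avoid g = f * g"
    by (simp add: algebra_simps)
  ultimately have prod: "avoid f * avoid g \<in> ?J"
    using ideal_add_cancel_left[OF ideal_var_ideal, of _ V C "avoid f * avoid g"] fg f g
    by (simp add: mpoly_ring_mult_closed carr)
  \<comment> \<open>No monomial of this product involves \<open>C\<close>, yet membership in the
    ideal demands that each does. So the product is zero, and one factor vanishes because
    polynomials form a domain.\<close>
  have "Poly_Mapping.keys (avoid f * avoid g) = {}"
  proof (rule ccontr)
    assume "Poly_Mapping.keys (avoid f * avoid g) \<noteq> {}"
    then obtain t where t: "t \<in> Poly_Mapping.keys (avoid f * avoid g)" by blast
    then obtain a b where "t = a + b" "a \<in> Poly_Mapping.keys (avoid f)" "b \<in> Poly_Mapping.keys (avoid g)"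
      using keys_mult[of "avoid f" "avoid g"] by blast
    then have "Poly_Mapping.keys t \<inter> C = {}" by (auto simp: keys_avoid keys_add_nat)
    then show False using t prod by (auto simp: var_ideal_def)
  qed
  then have "avoid f = 0 \<or> avoid g = 0" by simp
  then show "f \<in> ?J \<or> g \<in> ?J" using rest[OF f] rest[OF g] by auto
qed

section \<open>Renaming of variables and invariance of height\<close>

text \<open>On single terms \<open>map_key \<sigma>\<close> relabels \<open>\<sigma> s\<close> as
  \<open>s\<close>, which respects products because \<open>\<sigma>\<close> is additive; the general
  case follows by distributivity.\<close>

lemma map_key_mult:
  fixes \<sigma> :: "'a::comm_monoid_add \<Rightarrow> 'a" and p q :: "'a \<Rightarrow>\<^sub>0 'k::comm_semiring_1"
  assumes "bij \<sigma>" and add: "\<And>s t. \<sigma> (s + t) = \<sigma> s + \<sigma> t"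
  shows "Poly_Mapping.map_key \<sigma> (p * q) = Poly_Mapping.map_key \<sigma> p * Poly_Mapping.map_key \<sigma> q"
proof -
  let ?F = "Poly_Mapping.map_key \<sigma> :: ('a \<Rightarrow>\<^sub>0 'k) \<Rightarrow> _"
  have inj: "inj \<sigma>" using assms(1) by (rule bij_is_inj)
  have sum: "?F (sum f A) = (\<Sum>a \<in> A. ?F (f a))" for f :: "'a \<Rightarrow> _" and A
    by (induction A rule: infinite_finite_induct) (simp_all add: map_key_zero[OF inj] map_key_plus[OF inj])
  have single: "?F (Poly_Mapping.single s a * Poly_Mapping.single t b)
      = ?F (Poly_Mapping.single s a) * ?F (Poly_Mapping.single t b)" for s t a b
  proof -
    obtain s' t' where "s = \<sigma> s'" "t = \<sigma> t'" using assms(1) by (metis bij_pointE)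
    then show ?thesis by (simp add: mult_single add[symmetric] map_key_single[OF inj])
  qed
  have "?F ((\<Sum>s \<in> A. Poly_Mapping.single s (f s)) * (\<Sum>t \<in> B. Poly_Mapping.single t (g t)))
      = ?F (\<Sum>s \<in> A. Poly_Mapping.single s (f s)) * ?F (\<Sum>t \<in> B. Poly_Mapping.single t (g t))" for A B f g
    by (simp add: sum_product sum single)
  from this[of "Poly_Mapping.lookup p" "Poly_Mapping.keys p" "Poly_Mapping.lookup q" "Poly_Mapping.keys q"]
  show ?thesis by (simp add: poly_mapping_sum_keys)
qed

lemma vimage_eq_image_inverse:
  assumes "\<And>x. f (g x) = x" "\<And>x. g (f x) = x"
  shows "f -` A = g ` A"
proof
  show "f -` A \<subseteq> g ` A"
  proof
    fix x assume "x \<in> f -` A"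
    then have "g (f x) \<in> g ` A" by simp
    then show "x \<in> g ` A" by (simp add: assms)
  qed
qed (auto simp: assms)

text \<open>Renaming each variable \<open>v\<close> to \<open>\<sigma> v\<close> is an automorphism
  of the polynomial ring, and the preimage of the ideal of \<open>C'\<close> is the ideal of
  \<open>C\<close>.\<close>

lemma prime_height_var_ideal_le:
  fixes V :: "'v set"
  assumes \<sigma>: "bij \<sigma>" and V: "\<sigma> -` V = V" and C: "\<sigma> -` C' = C"
  shows "prime_height (mpoly_ring V) (var_ideal V C' :: ('v, 'k::field) mpoly set)
    \<le> prime_height (mpoly_ring V) (var_ideal V C :: ('v, 'k) mpoly set)"
proof -
  let ?R = "mpoly_ring V :: ('v, 'k) mpoly ring"
  define \<tau> where "\<tau> = inv_into UNIV \<sigma>"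
  \<comment> \<open>Two levels of renaming: \<open>?r\<close> and \<open>?r'\<close> act on exponent
    vectors, \<open>?F\<close> and \<open>?F'\<close> on polynomials. As \<open>map_key\<close>
    precomposes, \<open>?F\<close> moves the monomials by \<open>?r'\<close>, hence the variables by
    \<open>\<sigma>\<close>.\<close>
  let ?r = "Poly_Mapping.map_key \<sigma> :: ('v \<Rightarrow>\<^sub>0 nat) \<Rightarrow> _"
  let ?r' = "Poly_Mapping.map_key \<tau> :: ('v \<Rightarrow>\<^sub>0 nat) \<Rightarrow> _"
  let ?F = "Poly_Mapping.map_key ?r :: ('v, 'k) mpoly \<Rightarrow> _"
  let ?F' = "Poly_Mapping.map_key ?r' :: ('v, 'k) mpoly \<Rightarrow> _"
  have inj: "inj \<sigma>" "inj \<tau>" using \<sigma> by (auto simp: \<tau>_def bij_is_inj bij_imp_bij_inv)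
  have st: "\<sigma> (\<tau> x) = x" "\<tau> (\<sigma> x) = x" for x
    using \<sigma> by (auto simp: \<tau>_def bij_is_inj bij_is_surj surj_f_inv_f)
  have rr': "?r (?r' t) = t" "?r' (?r t) = t" for t
    using map_key_compose[OF inj(1) inj(2), of t] map_key_compose[OF inj(2) inj(1), of t] st map_key_id
    by (auto simp: comp_def)
  have r: "bij ?r" by (rule bij_betw_byWitness[where f' = ?r']) (auto simp: rr')
  have injr: "inj ?r" "inj ?r'" by (rule inj_on_inverseI, rule rr')+
  have FF': "?F (?F' p) = p" for p
    using map_key_compose[OF injr(1) injr(2), of p] map_key_id rr' by (auto simp: comp_def)
  have keys_F: "Poly_Mapping.keys (?F p) = ?r' ` Poly_Mapping.keys p" for p
    unfolding keys_map_key[OF injr(1)] by (rule vimage_eq_image_inverse) (rule rr')+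
  have keys_F': "Poly_Mapping.keys (?F' p) = ?r ` Poly_Mapping.keys p" for p
    unfolding keys_map_key[OF injr(2)] by (rule vimage_eq_image_inverse) (rule rr')+
  have keys_r: "Poly_Mapping.keys (?r t) = \<sigma> -` Poly_Mapping.keys t" for t
    by (rule keys_map_key[OF inj(1)])
  have keys_r': "Poly_Mapping.keys (?r' t) = \<sigma> ` Poly_Mapping.keys t" for t
    unfolding keys_map_key[OF inj(2)] by (rule vimage_eq_image_inverse) (rule st)+
  have carr: "?F p \<in> carrier ?R" "?F' p \<in> carrier ?R" if "p \<in> carrier ?R" for p
    using that V by (auto simp: mpoly_ring_carrier_iff keys_F keys_F' keys_r keys_r')
  have ring: "ring ?R" using mpoly_ring_cring by (rule cring.axioms(1))
  have F_mult: "?F (p * q) = ?F p * ?F q" for p q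
    by (rule map_key_mult[OF r]) (rule map_key_plus[OF inj(1)])
  have "ring_hom_ring ?R ?R ?F"
  proof (rule ring_hom_ringI[OF ring ring])
    show "?F \<one>\<^bsub>?R\<^esub> = \<one>\<^bsub>?R\<^esub>"
      using map_key_single[OF injr(1), of 0 "1::'k"]
      by (simp add: map_key_zero[OF inj(1)])
  qed (simp_all add: carr map_key_plus[OF injr(1)] F_mult)
  moreover have "?F ` carrier ?R = carrier ?R"
  proof
    show "carrier ?R \<subseteq> ?F ` carrier ?R"
      using carr(2) FF' by (metis image_eqI subsetI)
  qed (use carr(1) in blast)
  ultimately have "prime_height ?R (var_ideal V C')
      \<le> prime_height ?R {p \<in> carrier ?R. ?F p \<in> var_ideal V C'}"
    by (intro prime_height_vimage_ge mpoly_ring_cring)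
  also have "{p \<in> carrier ?R. ?F p \<in> var_ideal V C'} = var_ideal V C"
  proof -
    have "\<sigma> ` Poly_Mapping.keys t \<inter> C' = {} \<longleftrightarrow> Poly_Mapping.keys t \<inter> C = {}" for t :: "'v \<Rightarrow>\<^sub>0 nat"
      using C by auto
    then show ?thesis using carr(1) by (auto simp: var_ideal_def keys_F keys_r')
  qed
  finally show ?thesis .
qed

text \<open>Glue a bijection from \<open>C\<close> to \<open>C'\<close>, one between the complements
  in \<open>V\<close>, and the identity outside \<open>V\<close>. The result is a bijection of the
  whole type, as renaming by \<open>map_key\<close> calls for.\<close>

lemma ex_bij_vimage:
  assumes "finite V" "C \<subseteq> V" "C' \<subseteq> V" "card C = card C'"
  shows "\<exists>\<sigma>. bij \<sigma> \<and> \<sigma> -` V = V \<and> \<sigma> -` C' = C"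
proof -
  have fin: "finite C" "finite C'" using assms finite_subset by auto
  obtain f where f: "bij_betw f C C'"
    using finite_same_card_bij[OF fin assms(4)] by auto
  have "card (V - C) = card (V - C')" using assms fin by (simp add: card_Diff_subset)
  then obtain g where g: "bij_betw g (V - C) (V - C')"
    using finite_same_card_bij[of "V - C" "V - C'"] assms(1) by auto
  define \<sigma> where "\<sigma> x = (if x \<in> C then f x else if x \<in> V then g x else x)" for x
  have 1: "bij_betw \<sigma> C C'" using f by (rule bij_betw_cong[THEN iffD1, rotated]) (simp add: \<sigma>_def)
  have 2: "bij_betw \<sigma> (V - C) (V - C')"
    using g by (rule bij_betw_cong[THEN iffD1, rotated]) (simp add: \<sigma>_def)
  have 3: "bij_betw \<sigma> (- V) (- V)"
    using bij_betw_id by (rule bij_betw_cong[THEN iffD1, rotated]) (use assms in \<open>auto simp: \<sigma>_def\<close>)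
  have 4: "bij_betw \<sigma> V V"
    using bij_betw_combine[OF 1 2] assms by (simp add: Un_absorb1)
  have "bij \<sigma>" using bij_betw_combine[OF 4 3] by simp
  moreover have "\<sigma> -` V = V" using 4 \<open>bij \<sigma>\<close> by (metis bij_betw_imp_surj_on bij_is_inj inj_vimage_image_eq)
  moreover have "\<sigma> -` C' = C" using 1 \<open>bij \<sigma>\<close> by (metis bij_betw_imp_surj_on bij_is_inj inj_vimage_image_eq)
  ultimately show ?thesis by blast
qed

lemma prime_height_var_ideal_cong:
  fixes V :: "'v set"
  assumes "finite V" "C \<subseteq> V" "C' \<subseteq> V" "card C = card C'"
  shows "prime_height (mpoly_ring V) (var_ideal V C :: ('v, 'k::field) mpoly set)
    = prime_height (mpoly_ring V) (var_ideal V C' :: ('v, 'k) mpoly set)"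
proof (rule order_antisym)
  have le: "prime_height (mpoly_ring V) (var_ideal V B' :: ('v, 'k) mpoly set)
      \<le> prime_height (mpoly_ring V) (var_ideal V B :: ('v, 'k) mpoly set)"
    if "B \<subseteq> V" "B' \<subseteq> V" "card B = card B'" for B B'
    using ex_bij_vimage[OF assms(1) that] prime_height_var_ideal_le by blast
  show "prime_height (mpoly_ring V) (var_ideal V C :: ('v, 'k) mpoly set)
      \<le> prime_height (mpoly_ring V) (var_ideal V C' :: ('v, 'k) mpoly set)"
    by (rule le) (use assms in auto)
  show "prime_height (mpoly_ring V) (var_ideal V C' :: ('v, 'k) mpoly set)
      \<le> prime_height (mpoly_ring V) (var_ideal V C :: ('v, 'k) mpoly set)"
    by (rule le) (use assms in auto)
qed

section \<open>Vertex covers of the graphs of weak homomorphisms\<close>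

text \<open>Reachability is only a preorder, as directed cycles are allowed, and \<open>p\<close>
  may repeat vertices. Indices start at 1 to match the vertices of \<open>D m\<close>.\<close>

definition multichain :: "('a \<times> 'a) set \<Rightarrow> 'a set \<Rightarrow> nat \<Rightarrow> (nat \<Rightarrow> 'a) \<Rightarrow> bool" where
  "multichain E X m p \<longleftrightarrow> (\<forall>i \<in> {1..m}. p i \<in> X) \<and> (\<forall>i. 1 \<le> i \<and> i < m \<longrightarrow> (p i, p (Suc i)) \<in> E\<^sup>*)"

definition chain_cover :: "nat \<Rightarrow> (nat \<Rightarrow> 'a) \<Rightarrow> ('a \<times> nat) set" where
  "chain_cover m p = (\<lambda>i. (p i, i)) ` {1..m}"

text \<open>The second coordinates are distinct even if \<open>p\<close> repeats a vertex. This
  common size is what makes the heights equal.\<close>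

lemma card_chain_cover: "card (chain_cover m p) = m"
  unfolding chain_cover_def by (subst card_image) (auto simp: inj_on_def)

text \<open>Both ends of an arc take values in \<open>{1..m}\<close>, where being equal or joined by
  an edge of \<open>D m\<close> means \<open>\<le>\<close>.\<close>

lemma WHom_D_iff:
  assumes "pair_digraph G"
  shows "\<phi> \<in> WHom G (D m) \<longleftrightarrow>
    \<phi> \<in> pverts G \<rightarrow>\<^sub>E {1..m} \<and> (\<forall>(x, y) \<in> parcs G. \<phi> x \<le> \<phi> y)"
proof -
  interpret pair_digraph G by fact
  have "\<phi> x = \<phi> y \<or> (\<phi> x, \<phi> y) \<in> parcs (D m) \<longleftrightarrow> \<phi> x \<le> \<phi> y"
    if "\<phi> \<in> pverts G \<rightarrow>\<^sub>E {1..m}" "(x, y) \<in> parcs G" for x y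
  proof -
    have "x \<in> pverts G" "y \<in> pverts G" using that(2) by (auto dest: wellformed)
    then have "\<phi> x \<in> {1..m}" "\<phi> y \<in> {1..m}" using that(1) by (blast dest: PiE_mem)+
    then show ?thesis by (auto simp: D_def)
  qed
  then have "(\<forall>(x, y) \<in> parcs G. \<phi> x = \<phi> y \<or> (\<phi> x, \<phi> y) \<in> parcs (D m))
      \<longleftrightarrow> (\<forall>(x, y) \<in> parcs G. \<phi> x \<le> \<phi> y)" if "\<phi> \<in> pverts G \<rightarrow>\<^sub>E {1..m}"
    using that by (intro ball_cong refl) (clarsimp split: prod.split)
  moreover have "pverts (D m) = {1..m}" by (simp add: D_def)
  ultimately show ?thesis unfolding WHom_def by auto
qed

lemma WHom_D_rtrancl_mono:
  assumes "pair_digraph G" "\<phi> \<in> WHom G (D m)" "(x, y) \<in> (parcs G)\<^sup>*"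
  shows "\<phi> x \<le> \<phi> y"
  using assms(3)
proof induction
  case (step y z)
  have "\<phi> y \<le> \<phi> z" using assms(2) step.hyps(2) unfolding WHom_D_iff[OF assms(1)] by blast
  with step.IH show ?case by simp
qed simp

text \<open>The isotone self-map \<open>i \<mapsto> \<phi> (p i)\<close> of \<open>{1..m}\<close> has a fixed point.\<close>

lemma chain_cover_meets_WHom:
  assumes G: "pair_digraph G" and \<phi>: "\<phi> \<in> WHom G (D m)" and "m \<ge> 1"
    and p: "multichain (parcs G) (pverts G) m p"
  shows "\<exists>x \<in> pverts G. (x, \<phi> x) \<in> chain_cover m p"
proof -
  have range: "p i \<in> pverts G" "\<phi> (p i) \<in> {1..m}" if "i \<in> {1..m}" for i
    using p \<phi> that by (auto simp: multichain_def WHom_D_iff[OF G] PiE_iff)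
  have "\<exists>i \<in> {1..m}. \<phi> (p i) = i"
  proof (rule ccontr)
    assume no_fix: "\<not> ?thesis"
    \<comment> \<open>Without a fixed point, every value lies strictly above its index: this starts
      with values at least 1 and propagates by isotonicity. At index \<open>m\<close> it leaves the
      range.\<close>
    have "Suc i \<le> m \<Longrightarrow> Suc i < \<phi> (p (Suc i))" for i
    proof (induction i)
      case 0
      have "\<phi> (p 1) \<in> {1..m}" using range(2)[of 1] assms(3) by auto
      moreover have "\<phi> (p 1) \<noteq> 1" using no_fix assms(3) by auto
      ultimately show ?case by auto
    next
      case (Suc i)
      then have "(p (Suc i), p (Suc (Suc i))) \<in> (parcs G)\<^sup>*" using p by (auto simp: multichain_def)
      from WHom_D_rtrancl_mono[OF G \<phi> this] have "Suc (Suc i) \<le> \<phi> (p (Suc (Suc i)))" using Suc by auto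
      moreover have "\<phi> (p (Suc (Suc i))) \<noteq> Suc (Suc i)" using no_fix Suc.prems by auto
      ultimately show ?case by simp
    qed
    from this[of "m - 1"] have "m < \<phi> (p m)" using assms(3) by auto
    then show False using range(2)[of m] assms(3) by auto
  qed
  then obtain i where "i \<in> {1..m}" "\<phi> (p i) = i" by blast
  then show ?thesis using range(1)[of i] unfolding chain_cover_def by (intro bexI[of _ "p i"]) auto
qed

text \<open>\<open>chain_top E X C k\<close> is the set of vertices above the last element of a multichain of length
  \<open>k\<close> inside \<open>C\<close>.\<close>

fun chain_top :: "('a \<times> 'a) set \<Rightarrow> 'a set \<Rightarrow> ('a \<times> nat) set \<Rightarrow> nat \<Rightarrow> 'a set" where
  "chain_top E X C 0 = X"
| "chain_top E X C (Suc k) = {x \<in> X. \<exists>y \<in> chain_top E X C k. (y, Suc k) \<in> C \<and> (y, x) \<in> E\<^sup>*}"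

lemma chain_top_subset: "chain_top E X C k \<subseteq> X"
  by (cases k) auto

text \<open>Upward closure, by transitivity of reachability, is what will make the greedily defined
  map isotone.\<close>

lemma chain_top_up:
  assumes "x \<in> chain_top E X C k" "(x, y) \<in> E\<^sup>*" "y \<in> X"
  shows "y \<in> chain_top E X C k"
proof (cases k)
  case (Suc l)
  then obtain z where "z \<in> chain_top E X C l" "(z, Suc l) \<in> C" "(z, x) \<in> E\<^sup>*"
    using assms(1) by auto
  then show ?thesis using Suc assms(3) rtrancl_trans[OF _ assms(2)] by auto
qed (use assms in simp)

text \<open>The witnesses \<open>y\<close> of the recursion, collected in order, form the
  multichain. For \<open>k = 0\<close> it is empty and has no last element to compare with
  \<open>x\<close>.\<close>

lemma chain_top_multichain:
  assumes "x \<in> chain_top E X C k"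
  shows "\<exists>p. multichain E X k p \<and> chain_cover k p \<subseteq> C \<and> (k \<ge> 1 \<longrightarrow> (p k, x) \<in> E\<^sup>*)"
  using assms
proof (induction k arbitrary: x)
  case 0
  then show ?case by (auto simp: multichain_def chain_cover_def)
next
  case (Suc k)
  then obtain y where y: "y \<in> chain_top E X C k" "(y, Suc k) \<in> C" "(y, x) \<in> E\<^sup>*" by auto
  from Suc.IH[OF y(1)] obtain p where p: "multichain E X k p" "chain_cover k p \<subseteq> C"
    "k \<ge> 1 \<longrightarrow> (p k, y) \<in> E\<^sup>*" by blast
  have "y \<in> X" using chain_top_subset y(1) by (rule subsetD)
  then have "multichain E X (Suc k) (p(Suc k := y))"
    using p by (auto simp: multichain_def less_Suc_eq le_Suc_eq)
  moreover have "chain_cover (Suc k) (p(Suc k := y)) = insert (y, Suc k) (chain_cover k p)"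
    by (simp add: chain_cover_def atLeastAtMostSuc_conv)
  then have "chain_cover (Suc k) (p(Suc k := y)) \<subseteq> C" using p(2) y(2) by simp
  ultimately show ?case using y(3) by (intro exI[of _ "p(Suc k := y)"] conjI impI) (assumption, assumption, simp)
qed

text \<open>If \<open>C\<close> contains no such multichain, then sending \<open>x\<close> to the least \<open>k\<close> with
  \<open>x \<notin> chain_top k\<close> is isotone and its graph misses \<open>C\<close>.\<close>

lemma cover_contains_chain_cover:
  assumes G: "pair_digraph G"
    and cover: "\<And>\<phi>. \<phi> \<in> WHom G (D m) \<Longrightarrow> \<exists>x \<in> pverts G. (x, \<phi> x) \<in> C"
  shows "\<exists>p. multichain (parcs G) (pverts G) m p \<and> chain_cover m p \<subseteq> C"
proof (rule ccontr)
  assume none: "\<not> ?thesis"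
  interpret pair_digraph G by fact
  let ?A = "chain_top (parcs G) (pverts G) C"
  \<comment> \<open>A vertex in \<open>?A m\<close> would yield a multichain of length
    \<open>m\<close> inside \<open>C\<close>. Hence the least index below exists and is at most
    \<open>m\<close>.\<close>
  have empty: "x \<notin> ?A m" for x using none chain_top_multichain[of x] by blast
  define \<phi> where "\<phi> = restrict (\<lambda>x. LEAST k. x \<notin> ?A k) (pverts G)"
  have notin: "x \<notin> ?A (\<phi> x)" if "x \<in> pverts G" for x
    using LeastI[of "\<lambda>k. x \<notin> ?A k", OF empty] that by (simp add: \<phi>_def)
  have least: "\<phi> x \<le> k" if "x \<in> pverts G" "x \<notin> ?A k" for x k
    using Least_le[of "\<lambda>k. x \<notin> ?A k", OF that(2)] that(1) by (simp add: \<phi>_def)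
  have pos: "\<phi> x \<noteq> 0" if "x \<in> pverts G" for x
    using notin[OF that] that by (cases "\<phi> x") auto
  have "\<phi> x \<le> \<phi> y" if "(x, y) \<in> parcs G" for x y
  proof -
    have xy: "x \<in> pverts G" "y \<in> pverts G" using that by (auto dest: wellformed)
    \<comment> \<open>Contrapositive of upward closure: were \<open>x\<close> in this set,
      \<open>y\<close> would be too.\<close>
    have "x \<notin> ?A (\<phi> y)" using notin[OF xy(2)] chain_top_up[OF _ r_into_rtrancl[OF that] xy(2)] by auto
    then show ?thesis by (rule least[OF xy(1)])
  qed
  moreover have "\<phi> \<in> pverts G \<rightarrow>\<^sub>E {1..m}"
    using least[OF _ empty] pos by (auto simp: \<phi>_def Suc_le_eq)
  ultimately have "\<phi> \<in> WHom G (D m)" by (auto simp: WHom_D_iff[OF G])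
  from cover[OF this] obtain x where x: "x \<in> pverts G" "(x, \<phi> x) \<in> C" by blast
  obtain k where k: "\<phi> x = Suc k" using pos[OF x(1)] by (cases "\<phi> x") auto
  \<comment> \<open>By minimality \<open>x\<close> is still in \<open>?A k\<close>; as
    \<open>(x, Suc k) \<in> C\<close>, it serves as its own witness for
    \<open>?A (Suc k)\<close>.\<close>
  have "x \<in> ?A k" using least[OF x(1), of k] k by auto
  then have "x \<in> ?A (\<phi> x)" using x k by auto
  then show False using notin x by blast
qed

section \<open>The prime decomposition\<close>

text \<open>The squarefree exponent vector whose support is the graph of \<open>\<phi>\<close> on
  the vertex set.\<close>

definition graph_exponent :: "'a pair_pre_digraph \<Rightarrow> ('a \<Rightarrow> 'b) \<Rightarrow> 'a \<times> 'b \<Rightarrow>\<^sub>0 nat" where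
  "graph_exponent G \<phi> = (\<Sum>i \<in> pverts G. Poly_Mapping.single (i, \<phi> i) 1)"

lemma whom_monomial_eq: "whom_monomial G \<phi> = Poly_Mapping.single (graph_exponent G \<phi>) 1"
proof -
  have "(\<Prod>i \<in> A. mvar (i, \<phi> i)) = Poly_Mapping.single (\<Sum>i \<in> A. Poly_Mapping.single (i, \<phi> i) 1) 1" for A
    by (induction A rule: infinite_finite_induct) (simp_all add: mvar_def mult_single)
  then show ?thesis by (simp add: whom_monomial_def graph_exponent_def)
qed

lemma lookup_graph_exponent:
  assumes "finite (pverts G)"
  shows "Poly_Mapping.lookup (graph_exponent G \<phi>) (x, j) = (if x \<in> pverts G \<and> j = \<phi> x then 1 else 0)"
proof -
  have "Poly_Mapping.lookup (graph_exponent G \<phi>) (x, j) = (\<Sum>i \<in> pverts G. if i = x then (if j = \<phi> x then 1 else 0) else 0)"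
    unfolding graph_exponent_def lookup_sum
    by (rule sum.cong) (auto simp: lookup_single when_def)
  then show ?thesis using assms by simp
qed

lemma monomial_in_whom_ideal:
  assumes fin: "finite (pverts G)" and \<phi>: "\<phi> \<in> WHom G H"
    and t: "Poly_Mapping.keys t \<subseteq> pverts G \<times> pverts H"
    and graph: "\<And>x. x \<in> pverts G \<Longrightarrow> (x, \<phi> x) \<in> Poly_Mapping.keys t"
  shows "Poly_Mapping.single t c \<in> (whom_ideal G H :: (_, 'k::field) mpoly set)"
proof -
  interpret I: ideal "whom_ideal G H :: (_, 'k) mpoly set" "whom_ring G H" by (rule whom_ideal_ideal)
  \<comment> \<open>Divisibility of the monomial \<open>t\<close> by the generator: the truncated
    subtraction is exact because every \<open>(x, \<phi> x)\<close> has exponent at least 1 in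
    \<open>t\<close>.\<close>
  have t_eq: "t = (t - graph_exponent G \<phi>) + graph_exponent G \<phi>"
  proof (rule poly_mapping_eqI)
    fix v :: "'a \<times> 'b"
    obtain x j where "v = (x, j)" by (cases v)
    then show "Poly_Mapping.lookup t v = Poly_Mapping.lookup (t - graph_exponent G \<phi> + graph_exponent G \<phi>) v"
      using graph[of x] by (auto simp: lookup_add lookup_minus lookup_graph_exponent[OF fin] in_keys_iff)
  qed
  then have "Poly_Mapping.keys (t - graph_exponent G \<phi>) \<subseteq> Poly_Mapping.keys t"
    using keys_add_nat[of "t - graph_exponent G \<phi>" "graph_exponent G \<phi>"] by auto
  then have "Poly_Mapping.single (t - graph_exponent G \<phi>) c \<in> carrier (whom_ring G H :: (_, 'k) mpoly ring)"
    using t by (auto simp: whom_ring_def mpoly_ring_carrier_iff)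
  moreover have "whom_monomial G \<phi> \<in> (whom_ideal G H :: (_, 'k) mpoly set)"
    unfolding whom_ideal_def using \<phi> whom_monomial_closed
    by (intro subsetD[OF I.genideal_self]) auto
  ultimately have "Poly_Mapping.single (t - graph_exponent G \<phi>) c * whom_monomial G \<phi> \<in> whom_ideal G H"
    using I.I_l_closed by (fastforce simp: whom_ring_def)
  then show ?thesis using t_eq by (simp add: whom_monomial_eq mult_single)
qed

lemma whom_ideal_memI:
  assumes "\<And>t. t \<in> Poly_Mapping.keys f \<Longrightarrow>
    Poly_Mapping.single t (Poly_Mapping.lookup f t) \<in> (whom_ideal G H :: (_, 'k::field) mpoly set)"
  shows "f \<in> whom_ideal G H"
proof -
  interpret I: ideal "whom_ideal G H :: (_, 'k) mpoly set" "whom_ring G H" by (rule whom_ideal_ideal)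
  have add: "p + q \<in> whom_ideal G H" if "p \<in> whom_ideal G H" "q \<in> whom_ideal G H" for p q :: "(_, 'k) mpoly"
    using additive_subgroup.a_closed[OF I.additive_subgroup_axioms that] by (simp add: whom_ring_def)
  have zero: "(0 :: (_, 'k) mpoly) \<in> whom_ideal G H"
    using additive_subgroup.zero_closed[OF I.additive_subgroup_axioms] by (simp add: whom_ring_def)
  have "A \<subseteq> Poly_Mapping.keys f \<Longrightarrow>
    (\<Sum>t \<in> A. Poly_Mapping.single t (Poly_Mapping.lookup f t)) \<in> whom_ideal G H" for A
    by (induction A rule: infinite_finite_induct) (auto simp: zero intro!: add assms)
  from this[OF order_refl] show ?thesis by (simp add: poly_mapping_sum_keys)
qed

definition chain_covers :: "'a pair_pre_digraph \<Rightarrow> nat \<Rightarrow> ('a \<times> nat) set set" where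
  "chain_covers G m = {chain_cover m p | p. multichain (parcs G) (pverts G) m p}"

lemma chain_covers_subset: "C \<in> chain_covers G m \<Longrightarrow> C \<subseteq> pverts G \<times> {1..m}"
  by (auto simp: chain_covers_def chain_cover_def multichain_def)

text \<open>Each generator contains a variable from every chain cover, which gives one inclusion.
  The other is checked term by term: a monomial whose support meets every chain cover is divisible
  by some generator.\<close>

lemma whom_ideal_eq_Inter:
  assumes G: "pair_digraph G" and m: "m \<ge> 1"
  shows "(whom_ideal G (D m) :: (_, 'k::field) mpoly set) =
    {f \<in> carrier (whom_ring G (D m)). \<forall>J \<in> var_ideal (pverts G \<times> {1..m}) ` chain_covers G m. f \<in> J}"
    (is "_ = ?K")
proof
  let ?V = "pverts G \<times> {1..m}"
  interpret pair_digraph G by fact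
  have ring_eq: "whom_ring G (D m) = (mpoly_ring ?V :: (_, 'k) mpoly ring)"
    by (simp add: whom_ring_def D_def)
  interpret R: cring "whom_ring G (D m) :: (_, 'k) mpoly ring"
    unfolding whom_ring_def by (rule mpoly_ring_cring)
  show "whom_ideal G (D m) \<subseteq> ?K"
  proof -
    have "whom_ideal G (D m) \<subseteq> (var_ideal ?V C :: (_, 'k) mpoly set)" if C: "C \<in> chain_covers G m" for C
      unfolding whom_ideal_def
    proof (rule R.genideal_minimal)
      show "ideal (var_ideal ?V C :: (_, 'k) mpoly set) (whom_ring G (D m))" unfolding ring_eq by (rule ideal_var_ideal)
      have "whom_monomial G \<phi> \<in> (var_ideal ?V C :: (_, 'k) mpoly set)" if \<phi>: "\<phi> \<in> WHom G (D m)" for \<phi>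
      proof -
        obtain x where "x \<in> pverts G" "(x, \<phi> x) \<in> C"
          using chain_cover_meets_WHom[OF G \<phi> m] C by (auto simp: chain_covers_def)
        moreover from this have "(x, \<phi> x) \<in> Poly_Mapping.keys (graph_exponent G \<phi>)"
          by (simp add: in_keys_iff lookup_graph_exponent)
        ultimately have "Poly_Mapping.keys (graph_exponent G \<phi>) \<inter> C \<noteq> {}" by blast
        moreover have "whom_monomial G \<phi> \<in> carrier (whom_ring G (D m) :: (_, 'k) mpoly ring)"
          by (rule whom_monomial_closed[OF \<phi>])
        ultimately show ?thesis by (simp add: ring_eq var_ideal_def whom_monomial_eq)
      qed
      then show "whom_monomial G ` WHom G (D m) \<subseteq> (var_ideal ?V C :: (_, 'k) mpoly set)"
        by (rule image_subsetI)
    qed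
    moreover have "whom_ideal G (D m) \<subseteq> carrier (whom_ring G (D m) :: (_, 'k) mpoly ring)"
      by (rule subsetI) (rule ideal.Icarr[OF whom_ideal_ideal])
    ultimately show ?thesis by blast
  qed
  show "?K \<subseteq> whom_ideal G (D m)"
  proof
    fix f :: "(_, 'k) mpoly" assume f: "f \<in> ?K"
    show "f \<in> whom_ideal G (D m)"
    proof (rule whom_ideal_memI)
      fix t assume t: "t \<in> Poly_Mapping.keys f"
      have tV: "Poly_Mapping.keys t \<subseteq> ?V" using f t by (auto simp: ring_eq mpoly_ring_carrier_iff)
      have "\<exists>\<phi> \<in> WHom G (D m). \<forall>x \<in> pverts G. (x, \<phi> x) \<in> Poly_Mapping.keys t"
      proof (rule ccontr)
        \<comment> \<open>If the support of \<open>t\<close> contains no graph, its complement meets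
          every graph and so contains a chain cover. The prime of that cover cannot contain
          \<open>f\<close>.\<close>
        assume "\<not> ?thesis"
        then obtain p where p: "multichain (parcs G) (pverts G) m p"
            "chain_cover m p \<subseteq> - Poly_Mapping.keys t"
          using cover_contains_chain_cover[OF G, of m "- Poly_Mapping.keys t"] by blast
        then have "f \<in> var_ideal ?V (chain_cover m p)" using f by (auto simp: chain_covers_def)
        then show False using t p(2) by (auto simp: var_ideal_def)
      qed
      then show "Poly_Mapping.single t (Poly_Mapping.lookup f t) \<in> whom_ideal G (D m)"
        using monomial_in_whom_ideal[of G _ "D m" t] tV by (auto simp: D_def)
    qed
  qed
qed

theorem theorem3p14:
  fixes G :: "nat pair_pre_digraph" and n m :: nat
  assumes "simple_digraph G" and "pverts G = {1..n}" and "m \<ge> 1"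
  shows "unmixed (whom_ring G (D m)) (whom_ideal G (D m) :: (nat \<times> nat, 'k::field) mpoly set)"
proof -
  let ?V = "pverts G \<times> {1..m}"
  let ?R = "mpoly_ring ?V :: (nat \<times> nat, 'k) mpoly ring"
  let ?\<D> = "var_ideal ?V ` chain_covers G m :: (nat \<times> nat, 'k) mpoly set set"
  have G: "pair_digraph G" using assms(1) by (simp add: simple_digraph_def)
  have ring_eq: "whom_ring G (D m) = ?R" by (simp add: whom_ring_def D_def)
  have V: "finite ?V" using assms(2) by simp
  have "chain_covers G m \<subseteq> Pow ?V" using chain_covers_subset by blast
  then have "finite (chain_covers G m)" using V by (meson finite_Pow_iff finite_subset)
  then have sub: "associated_primes ?R (whom_ideal G (D m)) \<subseteq> ?\<D>"
  proof (intro cring.associated_primes_Inter[OF mpoly_ring_cring] finite_imageI)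
    \<comment> \<open>The lexicographic order on \<open>nat \<times> nat\<close> supplies the linear
      order on variables.\<close>
    show "primeideal J ?R" if "J \<in> ?\<D>" for J
      using that primeideal_var_ideal by auto
    show "whom_ideal G (D m) = {f \<in> carrier ?R. \<forall>J \<in> ?\<D>. f \<in> J}"
      using whom_ideal_eq_Inter[OF G assms(3), where 'k = 'k] unfolding ring_eq .
  qed
  have height: "prime_height ?R P = prime_height ?R Q" if PQ: "P \<in> ?\<D>" "Q \<in> ?\<D>" for P Q
  proof -
    obtain C where C: "P = var_ideal ?V C" "C \<in> chain_covers G m" using PQ(1) by (rule imageE)
    obtain C' where C': "Q = var_ideal ?V C'" "C' \<in> chain_covers G m" using PQ(2) by (rule imageE)
    have card: "card C = card C'" using C(2) C'(2) by (auto simp: chain_covers_def card_chain_cover)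
    show ?thesis unfolding C(1) C'(1)
      by (rule prime_height_var_ideal_cong[OF V chain_covers_subset[OF C(2)] chain_covers_subset[OF C'(2)] card])
  qed
  show ?thesis
    unfolding unmixed_def ring_eq by (intro ballI height subsetD[OF sub])
qed

end
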